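(* Let $X$ be a complex Banach space, $A\in L(X)$ a bounded linear operator, $\omega>0$, $c\in\mathbb{C}\setminus\{0\}$, and suppose that $c\neq e^{\omega\lambda}$ for all $\lambda\in\sigma(A)$. Let $f:\mathbb{R}\to X$ be continuous with $f(t+\omega)=cf(t)$ for all $t\in\mathbb{R}$. Then the problem $$\dot y=Ay+f(t)\ \text{ on }[0,\omega],\qquad y(\omega)=cy(0),$$ has exactly one solution $y\in C([0,\omega],X)$, and it is given by $$y(t)=\int_0^\omega K(t,s)f(s)\,ds,\qquad t\in[0,\omega],$$ where $$K(t,s)=\begin{cases}c\,e^{A(t-s)}(cI-e^{A\omega})^{-1}&\text{for } s\in[0,t],\\ e^{A(\omega+t-s)}(cI-e^{A\omega})^{-1}&\text{for } s\in(t,\omega].\end{cases}$$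
   Context: $\sigma(A)$ is the spectrum of $A$ and $I$ is the identity on $X$. The assumption on $c$ means $c\notin\sigma(e^{A\omega})$, so $cI-e^{A\omega}$ is invertible. *)

theory Defs
  imports "HOL-Analysis.Analysis"
begin

section \<open>Complex Banach spaces\<close>

text \<open>
  The distribution only has real normed spaces. A complex normed space is rendered as a
  real normed space with a compatible complex scalar multiplication.
\<close>

class scaleC =
  fixes scaleC :: "complex \<Rightarrow> 'a \<Rightarrow> 'a"  (infixr \<open>*\<^sub>C\<close> 75)

class complex_normed_vector = scaleC + real_normed_vector +
  assumes scaleC_add_right: "a *\<^sub>C (x + y) = a *\<^sub>C x + a *\<^sub>C y"
    and scaleC_add_left: "(a + b) *\<^sub>C x = a *\<^sub>C x + b *\<^sub>C x"
    and scaleC_scaleC: "a *\<^sub>C b *\<^sub>C x = (a * b) *\<^sub>C x"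
    and scaleC_of_real: "complex_of_real r *\<^sub>C x = r *\<^sub>R x"
    and norm_scaleC: "norm (a *\<^sub>C x) = cmod a * norm x"

lemma scaleC_one [simp]: "1 *\<^sub>C x = (x :: 'a::complex_normed_vector)"
  using scaleC_of_real[of 1 x] by simp

class complex_banach = complex_normed_vector + banach

instantiation complex :: complex_banach
begin

definition scaleC_complex :: "complex \<Rightarrow> complex \<Rightarrow> complex" where
  "scaleC_complex a x = a * x"

instance
  by standard (simp_all add: scaleC_complex_def algebra_simps norm_mult scaleR_conv_of_real)

end

lemma bounded_linear_scaleC:
  "bounded_linear (\<lambda>x::'a::complex_normed_vector. a *\<^sub>C x)"
proof (rule bounded_linear_intro[where K = "cmod a"])
  fix r and x :: 'a
  show "a *\<^sub>C (r *\<^sub>R x) = r *\<^sub>R (a *\<^sub>C x)"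
    by (simp add: scaleC_of_real[symmetric] scaleC_scaleC mult.commute)
qed (simp_all add: scaleC_add_right norm_scaleC mult.commute)

instantiation blinfun :: (real_normed_vector, complex_normed_vector) complex_normed_vector
begin

lift_definition scaleC_blinfun :: "complex \<Rightarrow> 'a \<Rightarrow>\<^sub>L 'b \<Rightarrow> 'a \<Rightarrow>\<^sub>L 'b" is
  "\<lambda>a T x. a *\<^sub>C T x"
  by (rule bounded_linear_compose[OF bounded_linear_scaleC])

instance
proof
  fix a b :: complex and r :: real and S T :: "'a \<Rightarrow>\<^sub>L 'b"
  show "a *\<^sub>C (S + T) = a *\<^sub>C S + a *\<^sub>C T"
    by transfer (simp add: scaleC_add_right)
  show "(a + b) *\<^sub>C T = a *\<^sub>C T + b *\<^sub>C T"
    by transfer (simp add: scaleC_add_left)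
  show "a *\<^sub>C b *\<^sub>C T = (a * b) *\<^sub>C T"
    by transfer (simp add: scaleC_scaleC)
  show "complex_of_real r *\<^sub>C T = r *\<^sub>R T"
    by transfer (simp add: scaleC_of_real)
  have le: "norm (c *\<^sub>C R) \<le> cmod c * norm R" for c and R :: "'a \<Rightarrow>\<^sub>L 'b"
  proof (rule norm_blinfun_bound)
    show "norm (blinfun_apply (c *\<^sub>C R) x) \<le> cmod c * norm R * norm x" for x
      using norm_blinfun[of R x]
      by (simp add: scaleC_blinfun.rep_eq norm_scaleC mult.assoc mult_left_mono)
  qed simp
  show "norm (a *\<^sub>C T) = cmod a * norm T"
  proof (cases "a = 0")
    case True
    then show ?thesis using le[of 0 T] by simp
  next
    case False
    have "T = inverse a *\<^sub>C a *\<^sub>C T"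
      using False by (intro blinfun_eqI) (simp add: scaleC_blinfun.rep_eq scaleC_scaleC)
    then have "norm T \<le> inverse (cmod a) * norm (a *\<^sub>C T)"
      using le[of "inverse a" "a *\<^sub>C T"] by (simp add: norm_inverse)
    then have "cmod a * norm T \<le> norm (a *\<^sub>C T)"
      using False by (simp add: field_simps)
    then show ?thesis using le[of a T] by simp
  qed
qed

end


section \<open>Bounded complex-linear operators\<close>

text \<open>
  The type \<open>'a \<Rightarrow>\<^sub>L 'a\<close> consists of the bounded real-linear operators; the following
  set is the algebra of bounded complex-linear ones.
\<close>

definition clinear_ops :: "('a::complex_normed_vector \<Rightarrow>\<^sub>L 'a) set" where
  "clinear_ops = {T. \<forall>a x. blinfun_apply T (a *\<^sub>C x) = a *\<^sub>C blinfun_apply T x}"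

definition op_invertible :: "('a::complex_normed_vector \<Rightarrow>\<^sub>L 'a) \<Rightarrow> bool" where
  "op_invertible T \<longleftrightarrow>
     (\<exists>S\<in>clinear_ops. S o\<^sub>L T = id_blinfun \<and> T o\<^sub>L S = id_blinfun)"

definition op_inverse :: "('a::complex_normed_vector \<Rightarrow>\<^sub>L 'a) \<Rightarrow> ('a \<Rightarrow>\<^sub>L 'a)" where
  "op_inverse T =
     (THE S. S \<in> clinear_ops \<and> S o\<^sub>L T = id_blinfun \<and> T o\<^sub>L S = id_blinfun)"

definition op_spectrum :: "('a::complex_normed_vector \<Rightarrow>\<^sub>L 'a) \<Rightarrow> complex set" where
  "op_spectrum T = {\<mu>. \<not> op_invertible (\<mu> *\<^sub>C id_blinfun - T)}"

text \<open>
  The class \<open>real_normed_algebra_1\<close> required by \<^const>\<open>exp\<close> excludes operator algebras of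
  trivial spaces, so the exponential series, convergent in operator norm, is written out.
\<close>

definition op_exp :: "('a::complex_banach \<Rightarrow>\<^sub>L 'a) \<Rightarrow> ('a \<Rightarrow>\<^sub>L 'a)" where
  "op_exp T = (\<Sum>n. inverse (fact n) *\<^sub>R (((o\<^sub>L) T ^^ n) id_blinfun))"

lemma op_inverse_eqI:
  assumes "S \<in> clinear_ops" "S o\<^sub>L T = id_blinfun" "T o\<^sub>L S = id_blinfun"
  shows "op_inverse T = S"
  unfolding op_inverse_def
proof (rule the_equality)
  fix R assume "R \<in> clinear_ops \<and> R o\<^sub>L T = id_blinfun \<and> T o\<^sub>L R = id_blinfun"
  then have "R (T x) = x" and "T (S x) = x" for x
    using assms(3) by (metis blinfun_apply_blinfun_compose blinfun_apply_id_blinfun)+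
  then show "R = S" by (metis blinfun_eqI)
qed (use assms in simp)

lemma norm_op_power_le:
  "norm (((o\<^sub>L) T ^^ n) id_blinfun) \<le> norm (T :: 'a::real_normed_vector \<Rightarrow>\<^sub>L 'a) ^ n"
proof (induction n)
  case 0
  show ?case by (simp add: norm_blinfun_id_le)
next
  case (Suc n)
  have "norm (((o\<^sub>L) T ^^ Suc n) id_blinfun) \<le> norm T * norm (((o\<^sub>L) T ^^ n) id_blinfun)"
    by (simp add: norm_blinfun_compose)
  also have "\<dots> \<le> norm T * norm T ^ n"
    by (rule mult_left_mono[OF Suc.IH]) simp
  finally show ?case by simp
qed

lemma summable_op_exp:
  fixes T :: "'a::complex_banach \<Rightarrow>\<^sub>L 'a"
  shows "summable (\<lambda>n. inverse (fact n) *\<^sub>R (((o\<^sub>L) T ^^ n) id_blinfun))"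
proof (rule summable_comparison_test'[where N = 0])
  show "summable (\<lambda>n. inverse (fact n) * norm T ^ n)"
    by (rule summable_exp)
  show "norm (inverse (fact n) *\<^sub>R (((o\<^sub>L) T ^^ n) id_blinfun)) \<le> inverse (fact n) * norm T ^ n"
    for n by (simp only: norm_scaleR) (simp add: norm_op_power_le mult_left_mono)
qed


section \<open>The boundary value problem\<close>

text \<open>
  Membership in \<^const>\<open>extensional\<close> identifies a function on \<open>[0, \<omega>]\<close> with its extension that
  takes a fixed dummy value elsewhere, so that uniqueness can be stated for functions on
  \<open>[0, \<omega>]\<close>. At the end points the derivative is one-sided.
\<close>

definition bvp_solution ::
  "('a::complex_banach \<Rightarrow>\<^sub>L 'a) \<Rightarrow> real \<Rightarrow> complex \<Rightarrow> (real \<Rightarrow> 'a) \<Rightarrow> (real \<Rightarrow> 'a) \<Rightarrow> bool" where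
  "bvp_solution A \<omega> c f y \<longleftrightarrow>
     y \<in> extensional {0..\<omega>} \<and> continuous_on {0..\<omega>} y \<and>
     (\<forall>t\<in>{0..\<omega>}. (y has_vector_derivative blinfun_apply A (y t) + f t) (at t within {0..\<omega>})) \<and>
     y \<omega> = c *\<^sub>C y 0"

definition bvp_kernel ::
  "('a::complex_banach \<Rightarrow>\<^sub>L 'a) \<Rightarrow> real \<Rightarrow> complex \<Rightarrow> real \<Rightarrow> real \<Rightarrow> ('a \<Rightarrow>\<^sub>L 'a)" where
  "bvp_kernel A \<omega> c t s =
     (if s \<le> t
      then c *\<^sub>C op_exp ((t - s) *\<^sub>R A) o\<^sub>L op_inverse (c *\<^sub>C id_blinfun - op_exp (\<omega> *\<^sub>R A))
      else op_exp ((\<omega> + t - s) *\<^sub>R A) o\<^sub>L op_inverse (c *\<^sub>C id_blinfun - op_exp (\<omega> *\<^sub>R A)))"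

end

theory Submission
  imports Defs
begin

text \<open>
  The spectral mapping step, \<open>c \<notin> \<sigma>(e\<^sup>T)\<close> if \<open>c \<noteq> e\<^sup>\<mu>\<close> for all \<open>\<mu> \<in> \<sigma>(T)\<close>, needs no functional
  calculus. Writing \<open>c = d\<^sup>2\<close>, one has \<open>c - e\<^sup>T = (d - e\<^bsup>T/2\<^esup>) (d + e\<^bsup>T/2\<^esup>)\<close>, and the hypothesis is
  inherited by \<open>T/2\<close> with \<open>d\<close> and with \<open>-d\<close>, so one may assume that \<open>T\<close> is small. If then \<open>c\<close> is
  not close to \<open>1\<close>, a Neumann series inverts \<open>c - e\<^sup>T\<close>. Otherwise \<open>c = e\<^sup>\<gamma>\<close> with \<open>\<gamma>\<close> small, and
  \<open>e\<^sup>T - c = c (T - \<gamma>) F\<close> with \<open>F = \<Sum> (T - \<gamma>)\<^sup>n / (n + 1)!\<close> close to the identity.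

  For the boundary value problem, variation of constants gives
  \<open>y(t) = e\<^bsup>tA\<^esup> (y(0) + G(t))\<close> with \<open>G(t) = \<integral>\<^sub>0\<^sup>t e\<^bsup>-sA\<^esup> f(s) ds\<close>, and the boundary condition becomes
  \<open>(c - e\<^bsup>\<omega>A\<^esup>) y(0) = e\<^bsup>\<omega>A\<^esup> G(\<omega>)\<close>.
\<close>

section \<open>Bounded complex-linear operators\<close>

lemma scaleC_zero_left [simp]: "0 *\<^sub>C x = (0 :: 'a::complex_normed_vector)"
  using scaleC_of_real[of 0 x] by simp

lemma scaleC_minus_left: "(- a) *\<^sub>C x = - (a *\<^sub>C (x :: 'a::complex_normed_vector))"
  by (metis add.right_inverse add_eq_0_iff scaleC_add_left scaleC_zero_left)

lemma scaleC_diff_left: "(a - b) *\<^sub>C x = a *\<^sub>C x - b *\<^sub>C (x :: 'a::complex_normed_vector)"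
  by (metis scaleC_add_left scaleC_minus_left uminus_add_conv_diff add.commute)

lemma scaleC_diff_right: "a *\<^sub>C (x - y) = a *\<^sub>C x - a *\<^sub>C (y :: 'a::complex_normed_vector)"
  by (rule linear_diff[OF bounded_linear.linear[OF bounded_linear_scaleC]])

lemma scaleR_scaleC: "r *\<^sub>R a *\<^sub>C x = (of_real r * a) *\<^sub>C (x :: 'a::complex_normed_vector)"
  by (metis scaleC_of_real scaleC_scaleC)

lemma scaleC_scaleR_commute: "a *\<^sub>C r *\<^sub>R x = r *\<^sub>R a *\<^sub>C (x :: 'a::complex_normed_vector)"
  by (metis scaleC_of_real scaleC_scaleC mult.commute)

lemma bounded_bilinear_scaleC:
  "bounded_bilinear (\<lambda>a (x::'a::complex_normed_vector). a *\<^sub>C x)"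
proof
  show "\<exists>K. \<forall>a x. norm (a *\<^sub>C (x::'a)) \<le> norm a * norm x * K"
    by (intro exI[of _ 1]) (simp add: norm_scaleC)
qed (simp_all add: scaleC_add_left scaleC_add_right scaleC_scaleR_commute
    scaleR_scaleC scaleR_conv_of_real)

lemma blinfun_compose_assoc: "(S o\<^sub>L T) o\<^sub>L U = S o\<^sub>L (T o\<^sub>L U)"
  by (rule blinfun_eqI) simp

lemma blinfun_compose_id [simp]: "T o\<^sub>L id_blinfun = T" "id_blinfun o\<^sub>L T = T"
  by (auto intro: blinfun_eqI)

lemma scaleC_blinfun_compose_left: "(a *\<^sub>C S) o\<^sub>L T = a *\<^sub>C (S o\<^sub>L T)"
  by (rule blinfun_eqI) (simp add: scaleC_blinfun.rep_eq)

text \<open>Operators of this type are a priori only real-linear, so a complex scalar can pass a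
  left factor only if that factor lies in \<open>clinear_ops\<close>. This is why such membership is
  tracked throughout.\<close>

lemma scaleC_blinfun_compose_right: "S \<in> clinear_ops \<Longrightarrow> S o\<^sub>L (a *\<^sub>C T) = a *\<^sub>C (S o\<^sub>L T)"
  by (rule blinfun_eqI) (simp add: scaleC_blinfun.rep_eq clinear_ops_def)

lemmas blinfun_compose_simps =
  bounded_bilinear.add_left[OF bounded_bilinear_blinfun_compose]
  bounded_bilinear.add_right[OF bounded_bilinear_blinfun_compose]
  bounded_bilinear.diff_left[OF bounded_bilinear_blinfun_compose]
  bounded_bilinear.diff_right[OF bounded_bilinear_blinfun_compose]
  bounded_bilinear.scaleR_left[OF bounded_bilinear_blinfun_compose]
  bounded_bilinear.scaleR_right[OF bounded_bilinear_blinfun_compose]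
  scaleC_blinfun_compose_left scaleC_blinfun_compose_right

section \<open>Closure properties of the complex-linear operators\<close>

lemma clinear_ops_id: "id_blinfun \<in> clinear_ops"
  by (simp add: clinear_ops_def)

lemma clinear_ops_compose: "S \<in> clinear_ops \<Longrightarrow> T \<in> clinear_ops \<Longrightarrow> S o\<^sub>L T \<in> clinear_ops"
  by (simp add: clinear_ops_def)

lemma clinear_ops_diff: "S \<in> clinear_ops \<Longrightarrow> T \<in> clinear_ops \<Longrightarrow> S - T \<in> clinear_ops"
  by (simp add: clinear_ops_def blinfun.diff_left scaleC_diff_right)

lemma clinear_ops_scaleC: "T \<in> clinear_ops \<Longrightarrow> a *\<^sub>C T \<in> clinear_ops"
  by (simp add: clinear_ops_def scaleC_blinfun.rep_eq scaleC_scaleC mult.commute)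

lemma clinear_ops_scaleR: "T \<in> clinear_ops \<Longrightarrow> r *\<^sub>R T \<in> clinear_ops"
  by (metis clinear_ops_scaleC scaleC_of_real)

lemma clinear_ops_power:
  fixes T :: "'a::complex_normed_vector \<Rightarrow>\<^sub>L 'a"
  shows "T \<in> clinear_ops \<Longrightarrow> ((o\<^sub>L) T ^^ n) id_blinfun \<in> clinear_ops"
  by (induction n) (simp_all add: clinear_ops_id clinear_ops_compose)

text \<open>Evaluation at a point is continuous, so complex linearity survives norm limits. This
  serves the Neumann series, the exponential and the factor \<open>F\<close> of
  \<open>op_exp_minus_id_factor\<close>.\<close>

lemma clinear_ops_suminf:
  assumes "summable F" and F: "\<And>n. F n \<in> clinear_ops"
  shows "suminf F \<in> clinear_ops"
proof -
  have ap: "(\<lambda>n. F n x) sums suminf F x" for x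
    using bounded_linear.sums[OF blinfun.bounded_linear_left summable_sums[OF assms(1)]] .
  have "suminf F (a *\<^sub>C x) = a *\<^sub>C suminf F x" for a x
  proof (rule sums_unique2)
    show "(\<lambda>n. F n (a *\<^sub>C x)) sums suminf F (a *\<^sub>C x)" by (rule ap)
    have "(\<lambda>n. a *\<^sub>C F n x) sums (a *\<^sub>C suminf F x)"
      by (rule bounded_linear.sums[OF bounded_linear_scaleC ap])
    then show "(\<lambda>n. F n (a *\<^sub>C x)) sums (a *\<^sub>C suminf F x)"
      using F by (simp add: clinear_ops_def)
  qed
  then show ?thesis by (simp add: clinear_ops_def)
qed

section \<open>Invertible operators and the Neumann series\<close>

lemma op_invertible_compose:
  assumes "op_invertible S" "op_invertible T"
  shows "op_invertible (S o\<^sub>L T)"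
proof -
  obtain S' T' where
    S': "S' \<in> clinear_ops" "S' o\<^sub>L S = id_blinfun" "S o\<^sub>L S' = id_blinfun" and
    T': "T' \<in> clinear_ops" "T' o\<^sub>L T = id_blinfun" "T o\<^sub>L T' = id_blinfun"
    using assms unfolding op_invertible_def by blast
  show ?thesis unfolding op_invertible_def
  proof (intro bexI conjI)
    show "(T' o\<^sub>L S') o\<^sub>L (S o\<^sub>L T) = id_blinfun"
      by (metis S'(2) T'(2) blinfun_compose_assoc blinfun_compose_id(2))
    show "(S o\<^sub>L T) o\<^sub>L (T' o\<^sub>L S') = id_blinfun"
      by (metis S'(3) T'(3) blinfun_compose_assoc blinfun_compose_id(2))
  qed (simp add: S' T' clinear_ops_compose)
qed

lemma op_invertible_scaleC:
  assumes "op_invertible T" "T \<in> clinear_ops" "a \<noteq> 0"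
  shows "op_invertible (a *\<^sub>C T)"
proof -
  obtain S where S: "S \<in> clinear_ops" "S o\<^sub>L T = id_blinfun" "T o\<^sub>L S = id_blinfun"
    using assms(1) unfolding op_invertible_def by blast
  show ?thesis unfolding op_invertible_def
    by (rule bexI[of _ "inverse a *\<^sub>C S"])
      (use assms S in \<open>simp_all add: blinfun_compose_simps scaleC_scaleC clinear_ops_scaleC\<close>)
qed

text \<open>The spectrum is defined through \<mu> - T, whereas the factorisation of e^T - c produces
  T - \<gamma>.\<close>

lemma op_invertible_minus_commute:
  assumes "op_invertible (a *\<^sub>C id_blinfun - T)" "T \<in> clinear_ops"
  shows "op_invertible (T - a *\<^sub>C id_blinfun)"
proof -
  have "op_invertible ((-1) *\<^sub>C (a *\<^sub>C id_blinfun - T))"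
    by (intro op_invertible_scaleC assms clinear_ops_diff clinear_ops_scaleC clinear_ops_id) auto
  then show ?thesis by (simp add: scaleC_minus_left)
qed

text \<open>Neumann series: composing the sum of all powers of \<open>T\<close> with
  \<open>T\<close>, on either side, drops the zeroth term, the identity.\<close>

lemma op_invertible_id_minus:
  fixes T :: "'a::complex_banach \<Rightarrow>\<^sub>L 'a"
  assumes "T \<in> clinear_ops" "norm T < 1"
  shows "op_invertible (id_blinfun - T)"
proof -
  define P where "P n = ((o\<^sub>L) T ^^ n) id_blinfun" for n
  \<comment> \<open>Powers are built by composing on the left; the right-handed recursion yields the
    inverse on the other side.\<close>
  have PS: "P (Suc n) = T o\<^sub>L P n" "P (Suc n) = P n o\<^sub>L T" for n
    unfolding P_def by (induction n) (auto simp: blinfun_compose_assoc[symmetric])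
  have sm: "summable P"
    by (rule summable_comparison_test'[where N = 0, OF summable_geometric[of "norm T"]])
      (use assms in \<open>simp_all add: P_def norm_op_power_le\<close>)
  have "P sums suminf P" using sm by (rule summable_sums)
  then have S: "(\<lambda>n. P (Suc n)) sums (suminf P - id_blinfun)"
    by (subst sums_Suc_iff) (simp add: P_def)
  have "(\<lambda>n. T o\<^sub>L P n) sums (T o\<^sub>L suminf P)"
    by (intro bounded_linear.sums[OF bounded_bilinear.bounded_linear_right[OF
            bounded_bilinear_blinfun_compose]] summable_sums sm)
  then have 1: "T o\<^sub>L suminf P = suminf P - id_blinfun"
    using S sums_unique2 by (simp add: PS(1)) blast
  have "(\<lambda>n. P n o\<^sub>L T) sums (suminf P o\<^sub>L T)"
    by (intro bounded_linear.sums[OF bounded_bilinear.bounded_linear_left[OF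
            bounded_bilinear_blinfun_compose]] summable_sums sm)
  then have 2: "suminf P o\<^sub>L T = suminf P - id_blinfun"
    using S sums_unique2 by (simp add: PS(2)) blast
  have "suminf P \<in> clinear_ops"
    by (rule clinear_ops_suminf[OF sm]) (simp add: P_def clinear_ops_power assms)
  then show ?thesis unfolding op_invertible_def
    by (intro bexI[of _ "suminf P"]) (simp_all add: blinfun_compose_simps 1 2)
qed

section \<open>The operator exponential\<close>

lemma clinear_ops_op_exp:
  fixes T :: "'a::complex_banach \<Rightarrow>\<^sub>L 'a"
  assumes "T \<in> clinear_ops"
  shows "op_exp T \<in> clinear_ops"
  unfolding op_exp_def
  by (intro clinear_ops_suminf summable_op_exp clinear_ops_scaleR clinear_ops_power assms)

lemma op_exp_zero [simp]: "op_exp 0 = (id_blinfun :: 'a::complex_banach \<Rightarrow>\<^sub>L 'a)"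
proof -
  have *: "((o\<^sub>L) 0 ^^ n) id_blinfun = (if n = 0 then id_blinfun else (0 :: 'a \<Rightarrow>\<^sub>L 'a))" for n
    by (cases n) auto
  show ?thesis unfolding op_exp_def *
    using suminf_finite[of "{0::nat}" "\<lambda>n. inverse (fact n) *\<^sub>R (if n = 0 then id_blinfun else 0)"]
    by simp
qed

lemma op_power_scaleR:
  fixes T :: "'a::real_normed_vector \<Rightarrow>\<^sub>L 'a"
  shows "((o\<^sub>L) (t *\<^sub>R T) ^^ n) id_blinfun = t ^ n *\<^sub>R ((o\<^sub>L) T ^^ n) id_blinfun"
proof (induction n)
  case (Suc n)
  have "((o\<^sub>L) (t *\<^sub>R T) ^^ Suc n) id_blinfun = (t *\<^sub>R T) o\<^sub>L (t ^ n *\<^sub>R ((o\<^sub>L) T ^^ n) id_blinfun)"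
    using Suc by simp
  also have "\<dots> = t ^ Suc n *\<^sub>R ((o\<^sub>L) T ^^ Suc n) id_blinfun"
    by (simp add: blinfun_compose_simps mult.commute)
  finally show ?case .
qed simp

text \<open>Termwise differentiation of a power series in t; the Weierstrass M-test on a bounded
  interval gives uniform convergence of the derived series.\<close>

lemma op_exp_has_vector_derivative:
  fixes A :: "'a::complex_banach \<Rightarrow>\<^sub>L 'a"
  shows "((\<lambda>t. op_exp (t *\<^sub>R A)) has_vector_derivative A o\<^sub>L op_exp (t *\<^sub>R A)) (at t within S)"
proof -
  define P where "P n = ((o\<^sub>L) A ^^ n) id_blinfun" for n
  define u where "u n t = (t ^ n * inverse (fact n)) *\<^sub>R P n" for n and t :: real
  \<comment> \<open>The factor \<open>of_nat n\<close> makes \<open>d 0\<close> vanish, so the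
    truncated \<open>n - 1\<close> is harmless; the later terms are those of \<open>u\<close>
    shifted by one and composed with \<open>A\<close>.\<close>
  define d where "d n t = (of_nat n * t ^ (n - 1) * inverse (fact n)) *\<^sub>R P n" for n and t :: real
  \<comment> \<open>The margin 1 puts t inside an open interval on which powers of s are bounded by
    powers of \<open>R\<close>.\<close>
  define R where "R = \<bar>t\<bar> + 1"
  define U where "U = {-R<..<R}"
  have R: "R > 0" "t \<in> U" by (auto simp: R_def U_def)
  have u_sums: "(\<lambda>n. u n s) sums op_exp (s *\<^sub>R A)" for s
    using summable_sums[OF summable_op_exp[of "s *\<^sub>R A"]]
    by (simp add: op_exp_def u_def P_def op_power_scaleR mult.commute)
  have dSuc: "d (Suc n) s = A o\<^sub>L u n s" for n s
    by (simp add: d_def u_def P_def blinfun_compose_simps field_simps del: of_nat_Suc)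
  have "(\<lambda>n. d (Suc n) s) sums (A o\<^sub>L op_exp (s *\<^sub>R A))" for s
    unfolding dSuc by (intro bounded_linear.sums[OF bounded_bilinear.bounded_linear_right[OF
            bounded_bilinear_blinfun_compose]] u_sums)
  then have d_sums: "(\<lambda>n. d n s) sums (A o\<^sub>L op_exp (s *\<^sub>R A))" for s
    by (subst (asm) sums_Suc_iff) (simp add: d_def)
  have bound: "norm (d (Suc n) s) \<le> norm A * (inverse (fact n) * (R * norm A) ^ n)"
    if "s \<in> U" for n s
  proof -
    have "norm (u n s) \<le> R ^ n * inverse (fact n) * norm A ^ n"
      unfolding u_def norm_scaleR P_def using that R
      by (intro mult_mono norm_op_power_le)
        (auto simp: U_def abs_mult power_abs intro!: power_mono mult_right_mono)
    then show ?thesis unfolding dSuc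
      by (intro order_trans[OF norm_blinfun_compose] mult_left_mono)
        (auto simp: power_mult_distrib mult_ac)
  qed
  have "uniform_limit U (\<lambda>n s. \<Sum>i<n. d i s) (\<lambda>s. \<Sum>i. d i s) sequentially"
  proof (rule Weierstrass_m_test)
    show "norm (d n s) \<le> (case n of 0 \<Rightarrow> 0 | Suc m \<Rightarrow> norm A * (inverse (fact m) * (R * norm A) ^ m))"
      if "s \<in> U" for n s
      using bound[OF that] by (cases n) (auto simp: d_def)
    show "summable (\<lambda>n. case n of 0 \<Rightarrow> 0 | Suc m \<Rightarrow> norm A * (inverse (fact m) * (R * norm A) ^ m))"
      by (subst summable_Suc_iff[symmetric]) (simp add: summable_mult summable_exp)
  qed
  then have ul: "uniform_limit U (\<lambda>n s. \<Sum>i<n. d i s) (\<lambda>s. A o\<^sub>L op_exp (s *\<^sub>R A)) sequentially"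
    using d_sums by (simp add: sums_iff)
  \<comment> \<open>Differentiating the series only yields some limit \<open>g\<close>; uniqueness
    of sums identifies it with the exponential below.\<close>
  have "\<exists>g. \<forall>s\<in>U. (\<lambda>n. u n s) sums g s \<and>
      (g has_derivative (\<lambda>h. h *\<^sub>R (A o\<^sub>L op_exp (s *\<^sub>R A)))) (at s within U)"
  proof (rule has_derivative_series)
    show "convex U" by (simp add: U_def)
    show "(u n has_derivative (\<lambda>h. h *\<^sub>R d n s)) (at s within U)" for n s
      unfolding u_def d_def by (auto intro!: derivative_eq_intros simp: mult_ac)
    show "\<forall>\<^sub>F n in sequentially. \<forall>s\<in>U. \<forall>h. norm ((\<Sum>i<n. h *\<^sub>R d i s) -
        h *\<^sub>R (A o\<^sub>L op_exp (s *\<^sub>R A))) \<le> e * norm h" if "e > 0" for e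
      using uniform_limitD[OF ul that]
    proof eventually_elim
      case (elim n)
      show ?case
      proof (intro ballI allI)
        fix s h assume "s \<in> U"
        have "(\<Sum>i<n. h *\<^sub>R d i s) - h *\<^sub>R (A o\<^sub>L op_exp (s *\<^sub>R A)) =
            h *\<^sub>R ((\<Sum>i<n. d i s) - (A o\<^sub>L op_exp (s *\<^sub>R A)))"
          by (simp add: scaleR_sum_right scaleR_diff_right)
        moreover have "norm ((\<Sum>i<n. d i s) - (A o\<^sub>L op_exp (s *\<^sub>R A))) \<le> e"
          using elim \<open>s \<in> U\<close> by (simp add: dist_norm less_imp_le)
        ultimately show "norm ((\<Sum>i<n. h *\<^sub>R d i s) - h *\<^sub>R (A o\<^sub>L op_exp (s *\<^sub>R A))) \<le> e * norm h"
          by (simp add: mult.commute[of e] mult_left_mono)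
      qed
    qed
    show "(\<lambda>n. u n t) sums op_exp (t *\<^sub>R A)" by (rule u_sums)
  qed (use R in simp)
  then obtain g where g: "\<And>s. s \<in> U \<Longrightarrow> (\<lambda>n. u n s) sums g s"
    "\<And>s. s \<in> U \<Longrightarrow> (g has_derivative (\<lambda>h. h *\<^sub>R (A o\<^sub>L op_exp (s *\<^sub>R A)))) (at s within U)"
    by blast
  have "((\<lambda>s. op_exp (s *\<^sub>R A)) has_derivative (\<lambda>h. h *\<^sub>R (A o\<^sub>L op_exp (t *\<^sub>R A)))) (at t within U)"
    by (rule has_derivative_transform[OF R(2) _ g(2)[OF R(2)]])
      (use g(1) u_sums sums_unique2 in blast)
  then have "((\<lambda>s. op_exp (s *\<^sub>R A)) has_derivative (\<lambda>h. h *\<^sub>R (A o\<^sub>L op_exp (t *\<^sub>R A)))) (at t)"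
    using R(2) by (simp add: U_def at_within_open[OF _ open_greaterThanLessThan])
  then show ?thesis
    unfolding has_vector_derivative_def by (rule has_derivative_at_withinI)
qed

section \<open>Commutation and addition laws for the exponential\<close>

lemma op_exp_commute:
  fixes S T :: "'a::complex_banach \<Rightarrow>\<^sub>L 'a"
  assumes "S o\<^sub>L T = T o\<^sub>L S"
  shows "op_exp S o\<^sub>L T = T o\<^sub>L op_exp S"
proof (rule sums_unique2)
  define u where "u n = inverse (fact n) *\<^sub>R (((o\<^sub>L) S ^^ n) id_blinfun)" for n
  have u: "u sums op_exp S"
    unfolding u_def op_exp_def by (intro summable_sums summable_op_exp)
  have c: "((o\<^sub>L) S ^^ n) id_blinfun o\<^sub>L T = T o\<^sub>L ((o\<^sub>L) S ^^ n) id_blinfun" for n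
  proof (induction n)
    case (Suc n)
    then show ?case by (simp add: blinfun_compose_assoc) (metis assms blinfun_compose_assoc)
  qed simp
  show "(\<lambda>n. u n o\<^sub>L T) sums (op_exp S o\<^sub>L T)"
    by (intro bounded_linear.sums[OF bounded_bilinear.bounded_linear_left[OF
            bounded_bilinear_blinfun_compose]] u)
  have "(\<lambda>n. T o\<^sub>L u n) sums (T o\<^sub>L op_exp S)"
    by (intro bounded_linear.sums[OF bounded_bilinear.bounded_linear_right[OF
            bounded_bilinear_blinfun_compose]] u)
  then show "(\<lambda>n. u n o\<^sub>L T) sums (T o\<^sub>L op_exp S)"
    by (simp add: u_def blinfun_compose_simps c)
qed

lemma op_exp_commute_scaleR:
  fixes A :: "'a::complex_banach \<Rightarrow>\<^sub>L 'a"
  shows "op_exp (t *\<^sub>R A) o\<^sub>L A = A o\<^sub>L op_exp (t *\<^sub>R A)"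
  by (rule op_exp_commute) (simp add: blinfun_compose_simps)

text \<open>\<open>A\<close> is placed on the right so that, in a product with a solution of X' = A
  X, the two terms of the product rule cancel.\<close>

lemma op_exp_neg_has_vector_derivative:
  fixes A :: "'a::complex_banach \<Rightarrow>\<^sub>L 'a"
  shows "((\<lambda>t. op_exp ((- t) *\<^sub>R A)) has_vector_derivative - (op_exp ((- t) *\<^sub>R A) o\<^sub>L A)) (at t within S)"
  using op_exp_has_vector_derivative[of "- A" t S]
  by (simp add: op_exp_commute_scaleR[of "- t" A, simplified]
      bounded_bilinear.minus_left[OF bounded_bilinear_blinfun_compose])

text \<open>The product has zero derivative, hence equals its value at 0. Replacing t by -t gives
  the other order.\<close>

lemma op_exp_neg_compose:
  fixes A :: "'a::complex_banach \<Rightarrow>\<^sub>L 'a"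
  shows "op_exp (t *\<^sub>R A) o\<^sub>L op_exp ((- t) *\<^sub>R A) = id_blinfun"
    and "op_exp ((- t) *\<^sub>R A) o\<^sub>L op_exp (t *\<^sub>R A) = id_blinfun"
proof -
  have *: "op_exp ((- t) *\<^sub>R B) o\<^sub>L op_exp (t *\<^sub>R B) = id_blinfun"
    for t and B :: "'a \<Rightarrow>\<^sub>L 'a"
  proof -
    have "((\<lambda>t. op_exp ((- t) *\<^sub>R B) o\<^sub>L op_exp (t *\<^sub>R B)) has_vector_derivative 0) (at s within UNIV)"
      for s
      by (rule has_vector_derivative_eq_rhs[OF
            bounded_bilinear.has_vector_derivative[OF bounded_bilinear_blinfun_compose
              op_exp_neg_has_vector_derivative op_exp_has_vector_derivative]])
        (simp add: blinfun_compose_assoc bounded_bilinear.minus_left[OF bounded_bilinear_blinfun_compose])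
    then obtain k where k: "\<And>s. op_exp ((- s) *\<^sub>R B) o\<^sub>L op_exp (s *\<^sub>R B) = k"
      using has_vector_derivative_zero_constant[OF convex_UNIV, of "\<lambda>t. op_exp ((- t) *\<^sub>R B) o\<^sub>L op_exp (t *\<^sub>R B)"]
      by auto
    show ?thesis using k[of t] k[of 0] by simp
  qed
  show "op_exp ((- t) *\<^sub>R A) o\<^sub>L op_exp (t *\<^sub>R A) = id_blinfun" by (rule *)
  show "op_exp (t *\<^sub>R A) o\<^sub>L op_exp ((- t) *\<^sub>R A) = id_blinfun" using *[of "- t" A] by simp
qed

text \<open>With the integrating factor e^(-tA), the product e^(-tA) X(t) is constant. Addition laws
  then follow by comparing differential equations and initial values instead of multiplying
  series.\<close>

lemma op_exp_ode_unique:
  fixes A :: "'a::complex_banach \<Rightarrow>\<^sub>L 'a"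
  assumes X: "\<And>t. (X has_vector_derivative A o\<^sub>L X t) (at t)"
  shows "X t = op_exp (t *\<^sub>R A) o\<^sub>L X 0"
proof -
  have "((\<lambda>t. op_exp ((- t) *\<^sub>R A) o\<^sub>L X t) has_vector_derivative 0) (at s within UNIV)" for s
    by (rule has_vector_derivative_eq_rhs[OF
          bounded_bilinear.has_vector_derivative[OF bounded_bilinear_blinfun_compose
            op_exp_neg_has_vector_derivative X]])
      (simp add: blinfun_compose_assoc bounded_bilinear.minus_left[OF bounded_bilinear_blinfun_compose])
  then obtain k where k: "\<And>s. op_exp ((- s) *\<^sub>R A) o\<^sub>L X s = k"
    using has_vector_derivative_zero_constant[OF convex_UNIV, of "\<lambda>t. op_exp ((- t) *\<^sub>R A) o\<^sub>L X t"]
    by auto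
  have "op_exp ((- t) *\<^sub>R A) o\<^sub>L X t = X 0" using k[of t] k[of 0] by simp
  then show ?thesis
    by (metis op_exp_neg_compose(1) blinfun_compose_assoc blinfun_compose_id(2))
qed

text \<open>As functions of s both sides solve X' = A X with value e^(tA) at 0.\<close>

lemma op_exp_add_scaleR:
  fixes A :: "'a::complex_banach \<Rightarrow>\<^sub>L 'a"
  shows "op_exp ((s + t) *\<^sub>R A) = op_exp (s *\<^sub>R A) o\<^sub>L op_exp (t *\<^sub>R A)"
proof -
  have "((\<lambda>s. op_exp ((s + t) *\<^sub>R A)) has_vector_derivative A o\<^sub>L op_exp ((s + t) *\<^sub>R A)) (at s)" for s
  proof -
    have "((\<lambda>s. s + t) has_vector_derivative 1) (at s)"
      by (auto intro!: derivative_eq_intros)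
    from vector_diff_chain_at[OF this op_exp_has_vector_derivative]
    show ?thesis by (simp add: o_def)
  qed
  from op_exp_ode_unique[of "\<lambda>s. op_exp ((s + t) *\<^sub>R A)", OF this] show ?thesis by simp
qed

text \<open>The curve \<open>?X\<close> solves the equation for A + \<gamma> and starts at the
  identity; the claim is its value at t = 1.\<close>

lemma op_exp_add_scaleC_id:
  fixes A :: "'a::complex_banach \<Rightarrow>\<^sub>L 'a"
  assumes "A \<in> clinear_ops"
  shows "op_exp (A + \<gamma> *\<^sub>C id_blinfun) = exp \<gamma> *\<^sub>C op_exp A"
proof -
  let ?X = "\<lambda>t::real. exp (t *\<^sub>R \<gamma>) *\<^sub>C op_exp (t *\<^sub>R A)"
  have "(?X has_vector_derivative (A + \<gamma> *\<^sub>C id_blinfun) o\<^sub>L ?X t) (at t)" for t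
    by (rule has_vector_derivative_eq_rhs[OF
          bounded_bilinear.has_vector_derivative[OF bounded_bilinear_scaleC
            exp_scaleR_has_vector_derivative_right op_exp_has_vector_derivative]])
      (simp add: assms blinfun_compose_simps scaleC_scaleC mult.commute)
  from op_exp_ode_unique[of ?X, OF this, of 1] show ?thesis by simp
qed

section \<open>Spectral mapping for the exponential\<close>

text \<open>\<mu> - aT = a(\<mu>/a - T). It is applied with a = 1/2 when halving the operator and
  with a = \<omega> at the end.\<close>

lemma op_spectrum_scaleC:
  assumes "T \<in> clinear_ops" "a \<noteq> 0" "\<mu> \<in> op_spectrum (a *\<^sub>C T)"
  shows "\<mu> / a \<in> op_spectrum T"
proof (rule ccontr)
  assume "\<mu> / a \<notin> op_spectrum T"
  then have "op_invertible (a *\<^sub>C ((\<mu> / a) *\<^sub>C id_blinfun - T))"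
    unfolding op_spectrum_def
    by (intro op_invertible_scaleC clinear_ops_diff clinear_ops_scaleC clinear_ops_id assms) auto
  then have "op_invertible (\<mu> *\<^sub>C id_blinfun - a *\<^sub>C T)"
    using \<open>a \<noteq> 0\<close> by (simp add: scaleC_diff_right scaleC_scaleC)
  then show False using assms(3) by (simp add: op_spectrum_def)
qed

text \<open>\<open>F\<close> is the power series of (e^z - 1)/z evaluated at \<open>T\<close>; its
  constant term is the identity and the rest is small with \<open>T\<close>.\<close>

lemma op_exp_minus_id_factor:
  fixes T :: "'a::complex_banach \<Rightarrow>\<^sub>L 'a"
  assumes "T \<in> clinear_ops" "norm T \<le> 1/2"
  obtains F where "F \<in> clinear_ops" "op_exp T - id_blinfun = T o\<^sub>L F" "norm (F - id_blinfun) \<le> 1/2"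
proof -
  define P where "P n = ((o\<^sub>L) T ^^ n) id_blinfun" for n
  define v where "v n = inverse (fact (Suc n)) *\<^sub>R P n" for n
  have P: "norm (P n) \<le> (1/2) ^ n" for n
    unfolding P_def by (rule order_trans[OF norm_op_power_le power_mono]) (use assms in auto)
  \<comment> \<open>The bounds 1/(n+2)! \<le> 1/2 and (1/2)^(n+1) for the power give a geometric
    majorant with sum 1/2.\<close>
  have vSuc: "norm (v (Suc n)) \<le> 1/4 * (1/2) ^ n" for n
  proof -
    have "(fact 2 :: real) \<le> fact (Suc (Suc n))" by (rule fact_mono) simp
    then have "inverse (fact (Suc (Suc n))) \<le> (1/2 :: real)"
      by (simp add: field_simps del: fact_Suc)
    then have "norm (v (Suc n)) \<le> 1/2 * (1/2) ^ Suc n"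
      unfolding v_def norm_scaleR by (intro mult_mono P) (auto simp del: fact_Suc)
    then show ?thesis by simp
  qed
  have g: "(\<lambda>n. 1/4 * (1/2) ^ n :: real) sums (1/2)"
    using sums_mult[OF geometric_sums[of "1/2::real"], of "1/4"] by simp
  have sm': "summable (\<lambda>n. v (Suc n))"
    by (rule summable_comparison_test'[OF sums_summable[OF g], of 0]) (rule vSuc)
  then have sm: "summable v" by (subst (asm) summable_Suc_iff)
  define F where "F = suminf v"
  show thesis
  proof
    show "F \<in> clinear_ops" unfolding F_def
      by (intro clinear_ops_suminf[OF sm]) (simp add: v_def P_def clinear_ops_scaleR clinear_ops_power assms)
    have "(\<lambda>n. T o\<^sub>L v n) sums (T o\<^sub>L F)"
      unfolding F_def by (intro bounded_linear.sums[OF bounded_bilinear.bounded_linear_right[OF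
            bounded_bilinear_blinfun_compose]] summable_sums sm)
    moreover have "(\<lambda>n. inverse (fact (Suc n)) *\<^sub>R P (Suc n)) sums (op_exp T - id_blinfun)"
      by (subst sums_Suc_iff[where f = "\<lambda>n. inverse (fact n) *\<^sub>R P n"])
        (use summable_sums[OF summable_op_exp[of T]] in \<open>simp add: P_def op_exp_def\<close>)
    moreover have "inverse (fact (Suc n)) *\<^sub>R P (Suc n) = T o\<^sub>L v n" for n
      by (simp add: v_def P_def blinfun_compose_simps del: fact_Suc)
    ultimately show "op_exp T - id_blinfun = T o\<^sub>L F"
      using sums_unique2 by simp
    have "F - id_blinfun = (\<Sum>n. v (Suc n))"
      using suminf_split_head[OF sm] by (simp add: F_def v_def P_def)
    also have "norm \<dots> \<le> 1/2"
      using norm_suminf_le[OF vSuc sums_summable[OF g]] g by (simp add: sums_iff)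
    finally show "norm (F - id_blinfun) \<le> 1/2" .
  qed
qed

text \<open>The thresholds fit together: e^T - 1 has norm at most 1/8 * 3/2 < 1/4, which handles c
  far from 1. For c near 1, |Ln c| \<le> 1/4 + 1/12 < 3/8, so T - Ln c has norm at most 1/2, as
  \<open>op_exp_minus_id_factor\<close> requires.\<close>

lemma op_invertible_minus_op_exp_small:
  fixes T :: "'a::complex_banach \<Rightarrow>\<^sub>L 'a"
  assumes T: "T \<in> clinear_ops" "norm T \<le> 1/8" and "c \<noteq> 0"
    and spec: "\<And>\<mu>. \<mu> \<in> op_spectrum T \<Longrightarrow> c \<noteq> exp \<mu>"
  shows "op_invertible (c *\<^sub>C id_blinfun - op_exp T)"
proof (cases "cmod (c - 1) > 1/4")
  case True
  obtain F where F: "F \<in> clinear_ops" "op_exp T - id_blinfun = T o\<^sub>L F" "norm (F - id_blinfun) \<le> 1/2"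
    using op_exp_minus_id_factor[of T] T by auto
  have "norm F \<le> 3/2"
    using norm_triangle_ineq[of "F - id_blinfun" id_blinfun] F(3) norm_blinfun_id_le[where 'a='a] by simp
  have "norm (op_exp T - id_blinfun) \<le> norm T * norm F"
    unfolding F(2) by (rule norm_blinfun_compose)
  also have "\<dots> \<le> 1/8 * (3/2)"
    using T \<open>norm F \<le> 3/2\<close> by (intro mult_mono) auto
  finally have le: "norm (op_exp T - id_blinfun) < cmod (c - 1)"
    using True by simp
  have "c \<noteq> 1" using True by auto
  \<comment> \<open>Chosen so that c - e^T = (c - 1)(1 - N).\<close>
  define N where "N = inverse (c - 1) *\<^sub>C (op_exp T - id_blinfun)"
  have N: "N \<in> clinear_ops"
    unfolding N_def by (intro clinear_ops_scaleC clinear_ops_diff clinear_ops_op_exp clinear_ops_id T)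
  have "norm N = norm (op_exp T - id_blinfun) / cmod (c - 1)"
    by (simp add: N_def norm_scaleC norm_inverse divide_inverse mult.commute)
  then have "norm N < 1"
    using le \<open>c \<noteq> 1\<close> by (simp add: divide_less_eq)
  then have "op_invertible ((c - 1) *\<^sub>C (id_blinfun - N))"
    using N \<open>c \<noteq> 1\<close>
    by (intro op_invertible_scaleC op_invertible_id_minus clinear_ops_diff clinear_ops_id) auto
  also have "(c - 1) *\<^sub>C (id_blinfun - N) = c *\<^sub>C id_blinfun - op_exp T"
    using \<open>c \<noteq> 1\<close> by (simp add: N_def scaleC_diff_right scaleC_scaleC scaleC_diff_left)
  finally show ?thesis .
next
  case False
  define \<gamma> where "\<gamma> = Ln c"
  have c: "exp \<gamma> = c" using \<open>c \<noteq> 0\<close> by (simp add: \<gamma>_def)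
  have "cmod (\<gamma> - (c - 1)) \<le> (cmod (c - 1))\<^sup>2 / (1 - cmod (c - 1))"
    using Ln_approx_linear[of "c - 1"] False by (simp add: \<gamma>_def)
  also have "\<dots> \<le> (1/4)\<^sup>2 / (1 - 1/4)"
    using False by (intro frac_le power_mono) auto
  finally have "cmod \<gamma> \<le> 3/8"
    using False norm_triangle_ineq[of "\<gamma> - (c - 1)" "c - 1"] by (simp add: power2_eq_square)
  define S where "S = T - \<gamma> *\<^sub>C id_blinfun"
  have S: "S \<in> clinear_ops"
    unfolding S_def by (intro clinear_ops_diff clinear_ops_scaleC clinear_ops_id T)
  have "norm (\<gamma> *\<^sub>C (id_blinfun :: 'a \<Rightarrow>\<^sub>L 'a)) \<le> 3/8 * 1"
    unfolding norm_scaleC using \<open>cmod \<gamma> \<le> 3/8\<close> by (intro mult_mono norm_blinfun_id_le) auto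
  then have "norm S \<le> 1/2"
    using T norm_triangle_ineq4[of T "\<gamma> *\<^sub>C id_blinfun"] by (simp add: S_def)
  then obtain F where F: "F \<in> clinear_ops" "op_exp S - id_blinfun = S o\<^sub>L F" "norm (F - id_blinfun) \<le> 1/2"
    using op_exp_minus_id_factor[of S] S by auto
  have "op_exp T = op_exp (S + \<gamma> *\<^sub>C id_blinfun)" by (simp add: S_def)
  also have "\<dots> = c *\<^sub>C op_exp S" by (simp add: op_exp_add_scaleC_id S c)
  finally have "c *\<^sub>C id_blinfun - op_exp T = (- c) *\<^sub>C (S o\<^sub>L F)"
    by (simp add: F(2)[symmetric] scaleC_diff_right scaleC_minus_left)
  moreover have "op_invertible F"
  proof -
    have "op_invertible (id_blinfun - (id_blinfun - F))"
      by (intro op_invertible_id_minus clinear_ops_diff clinear_ops_id F)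
        (use F(3) in \<open>simp add: norm_minus_commute\<close>)
    then show ?thesis by simp
  qed
  \<comment> \<open>The spectral hypothesis enters here: c = exp \<gamma> forces \<gamma> outside
    the spectrum of \<open>T\<close>.\<close>
  moreover have "op_invertible S"
    unfolding S_def using T spec[of \<gamma>] c
    by (intro op_invertible_minus_commute) (auto simp: op_spectrum_def)
  ultimately show ?thesis
    using S F(1) \<open>c \<noteq> 0\<close>
    by (simp add: op_invertible_scaleC op_invertible_compose clinear_ops_compose)
qed

lemma op_invertible_minus_op_exp:
  fixes T :: "'a::complex_banach \<Rightarrow>\<^sub>L 'a"
  assumes "T \<in> clinear_ops" "c \<noteq> 0" "\<And>\<mu>. \<mu> \<in> op_spectrum T \<Longrightarrow> c \<noteq> exp \<mu>"
  shows "op_invertible (c *\<^sub>C id_blinfun - op_exp T)"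
proof -
  obtain n where "8 * norm T < 2 ^ n"
    using real_arch_pow[of 2 "8 * norm T"] by auto
  then have "norm T \<le> 2 ^ n / 8" by simp
  then show ?thesis using assms
  \<comment> \<open>Each step halves \<open>T\<close> and replaces \<open>c\<close> by its two
    square roots, so both are generalised.\<close>
  proof (induction n arbitrary: T c)
    case 0
    then show ?case by (intro op_invertible_minus_op_exp_small) auto
  next
    case (Suc n)
    define S where "S = (1/2) *\<^sub>C T"
    define d where "d = csqrt c"
    have d: "d * d = c" "d \<noteq> 0"
      using Suc.prems(3) power2_csqrt[of c] by (auto simp: d_def power2_eq_square)
    have S: "S \<in> clinear_ops" "norm S \<le> 2 ^ n / 8"
      using Suc.prems by (auto simp: S_def norm_scaleC intro: clinear_ops_scaleC)
    have E: "op_exp S \<in> clinear_ops" by (intro clinear_ops_op_exp S)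
    \<comment> \<open>Stated for any square root e of c, so as to serve both d and -d: e = exp \<mu>
      would give c = exp (2\<mu>) with 2\<mu> in the spectrum of \<open>T\<close>.\<close>
    have spec: "e \<noteq> exp \<mu>" if "\<mu> \<in> op_spectrum S" "e * e = c" for e \<mu>
    proof
      assume "e = exp \<mu>"
      then have "c = exp (\<mu> + \<mu>)" using that(2) by (simp only: exp_add)
      then have "c = exp (\<mu> / (1/2))" by (simp add: mult.commute)
      with Suc.prems(4) show False
        using op_spectrum_scaleC[of T "1/2" \<mu>] Suc.prems(2) that(1) by (auto simp: S_def)
    qed
    have "S = (1/2 :: real) *\<^sub>R T"
      using scaleC_of_real[of "1/2" T] by (simp add: S_def)
    then have dbl: "op_exp T = op_exp S o\<^sub>L op_exp S"
      using op_exp_add_scaleR[of "1/2" "1/2" T] by simp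
    have 1: "op_invertible (d *\<^sub>C id_blinfun - op_exp S)"
      by (rule Suc.IH) (use S d spec in auto)
    have "op_invertible ((- d) *\<^sub>C id_blinfun - op_exp S)"
      by (rule Suc.IH) (use S d spec[where e = "- d"] in auto)
    \<comment> \<open>This operator is d + e^S, the second factor of d^2 - e^(2S).\<close>
    then have 2: "op_invertible ((-1) *\<^sub>C ((- d) *\<^sub>C id_blinfun - op_exp S))"
      by (intro op_invertible_scaleC clinear_ops_diff clinear_ops_scaleC clinear_ops_id E) auto
    have "(d *\<^sub>C id_blinfun - op_exp S) o\<^sub>L ((-1) *\<^sub>C ((- d) *\<^sub>C id_blinfun - op_exp S)) =
        c *\<^sub>C id_blinfun - op_exp T"
      by (simp add: dbl scaleC_minus_left blinfun_compose_simps scaleC_scaleC d clinear_ops_id E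
          bounded_bilinear.minus_right[OF bounded_bilinear_blinfun_compose])
    then show ?case using op_invertible_compose[OF 1 2] by simp
  qed
qed

section \<open>The boundary value problem\<close>

lemma op_inverse:
  assumes "op_invertible T"
  shows "op_inverse T o\<^sub>L T = id_blinfun" "T o\<^sub>L op_inverse T = id_blinfun"
  using assms op_inverse_eqI unfolding op_invertible_def by blast+

text \<open>Lets the inverse in the kernel move past the exponentials.\<close>

lemma op_inverse_commute:
  assumes "op_invertible T" "T o\<^sub>L S = S o\<^sub>L T"
  shows "op_inverse T o\<^sub>L S = S o\<^sub>L op_inverse T"
  by (metis assms blinfun_compose_assoc blinfun_compose_id op_inverse)

section \<open>Variation of constants\<close>

lemma has_integral_blinfun:
  "(g has_integral i) S \<Longrightarrow> ((\<lambda>s. blinfun_apply T (g s)) has_integral T i) S"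
  using has_integral_linear[OF _ blinfun.bounded_linear_right] by (simp add: o_def)

lemma continuous_on_op_exp_neg_apply:
  fixes A :: "'a::complex_banach \<Rightarrow>\<^sub>L 'a"
  assumes "continuous_on S f"
  shows "continuous_on S (\<lambda>s. op_exp ((- s) *\<^sub>R A) (f s))"
  by (intro bounded_bilinear.continuous_on[OF bounded_bilinear_blinfun_apply] assms
      continuous_on_vector_derivative[OF op_exp_neg_has_vector_derivative])

text \<open>In the derivative of e^(-sA) y(s) the terms with \<open>A\<close> cancel, leaving
  e^(-sA) f(s), which is integrated over [0,t].\<close>

lemma variation_of_constants:
  fixes A :: "'a::complex_banach \<Rightarrow>\<^sub>L 'a"
  assumes y: "\<And>t. t \<in> {0..b} \<Longrightarrow> (y has_vector_derivative A (y t) + f t) (at t within {0..b})"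
    and t: "t \<in> {0..b}"
  shows "y t = op_exp (t *\<^sub>R A) (y 0 + integral {0..t} (\<lambda>s. op_exp ((- s) *\<^sub>R A) (f s)))"
proof -
  have "((\<lambda>s. op_exp ((- s) *\<^sub>R A) (f s)) has_integral
      op_exp ((- t) *\<^sub>R A) (y t) - op_exp ((- 0) *\<^sub>R A) (y 0)) {0..t}"
  proof (rule fundamental_theorem_of_calculus)
    fix s assume s: "s \<in> {0..t}"
    have y': "(y has_vector_derivative A (y s) + f s) (at s within {0..t})"
      by (rule has_vector_derivative_within_subset[OF y]) (use s t in auto)
    show "((\<lambda>s. op_exp ((- s) *\<^sub>R A) (y s)) has_vector_derivative op_exp ((- s) *\<^sub>R A) (f s))
        (at s within {0..t})"
      by (rule has_vector_derivative_eq_rhs[OF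
            bounded_bilinear.has_vector_derivative[OF bounded_bilinear_blinfun_apply
              op_exp_neg_has_vector_derivative y']])
        (simp add: blinfun.bilinear_simps)
  qed (use t in auto)
  from integral_unique[OF this]
  have "y 0 + integral {0..t} (\<lambda>s. op_exp ((- s) *\<^sub>R A) (f s)) = op_exp ((- t) *\<^sub>R A) (y t)"
    by simp
  moreover have "op_exp (t *\<^sub>R A) (op_exp ((- t) *\<^sub>R A) (y t)) = y t"
    by (simp only: op_exp_neg_compose blinfun_apply_id_blinfun flip: blinfun_apply_blinfun_compose)
  ultimately show ?thesis by (simp only:)
qed

text \<open>Converse of \<open>variation_of_constants\<close>, for an arbitrary initial value
  \<open>x\<close>: in the product rule the second term is e^(tA) e^(-tA) f(t) = f(t).\<close>

lemma op_exp_convolution_has_vector_derivative: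
  fixes A :: "'a::complex_banach \<Rightarrow>\<^sub>L 'a" and x :: 'a
  assumes "continuous_on {0..b} f" "t \<in> {0..b}"
  defines "y \<equiv> \<lambda>t. op_exp (t *\<^sub>R A) (x + integral {0..t} (\<lambda>s. op_exp ((- s) *\<^sub>R A) (f s)))"
  shows "(y has_vector_derivative A (y t) + f t) (at t within {0..b})"
proof -
  have "((\<lambda>t. x + integral {0..t} (\<lambda>s. op_exp ((- s) *\<^sub>R A) (f s))) has_vector_derivative
      0 + op_exp ((- t) *\<^sub>R A) (f t)) (at t within {0..b})"
    by (intro has_vector_derivative_add has_vector_derivative_const integral_has_vector_derivative
        continuous_on_op_exp_neg_apply assms)
  from bounded_bilinear.has_vector_derivative[OF bounded_bilinear_blinfun_apply
      op_exp_has_vector_derivative this]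
  show ?thesis
    unfolding y_def
    by (rule has_vector_derivative_eq_rhs)
      (simp del: scaleR_minus_left add: op_exp_neg_compose flip: blinfun_apply_blinfun_compose)
qed

section \<open>Boundary condition and integral kernel\<close>

lemma bvp_solution_formula:
  fixes A :: "'a::complex_banach \<Rightarrow>\<^sub>L 'a"
  assumes "\<omega> > 0" and inv: "op_invertible (c *\<^sub>C id_blinfun - op_exp (\<omega> *\<^sub>R A))"
    and y: "bvp_solution A \<omega> c f y" and t: "t \<in> {0..\<omega>}"
  defines "M \<equiv> op_inverse (c *\<^sub>C id_blinfun - op_exp (\<omega> *\<^sub>R A))"
  defines "G \<equiv> \<lambda>t. integral {0..t} (\<lambda>s. op_exp ((- s) *\<^sub>R A) (f s))"
  shows "y t = op_exp (t *\<^sub>R A) (M (op_exp (\<omega> *\<^sub>R A) (G \<omega>)) + G t)"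
proof -
  let ?D = "c *\<^sub>C id_blinfun - op_exp (\<omega> *\<^sub>R A)"
  have yt: "y t = op_exp (t *\<^sub>R A) (y 0 + G t)" if "t \<in> {0..\<omega>}" for t
    unfolding G_def by (rule variation_of_constants[OF _ that]) (use y in \<open>simp add: bvp_solution_def\<close>)
  have "y \<omega> = c *\<^sub>C y 0" using y by (simp add: bvp_solution_def)
  \<comment> \<open>At t = \<omega> the formula turns the boundary condition into c y(0) =
    e^(\<omega>A) (y(0) + G(\<omega>)).\<close>
  then have "?D (y 0) = op_exp (\<omega> *\<^sub>R A) (G \<omega>)"
    using yt[of \<omega>] \<open>\<omega> > 0\<close> by (simp add: blinfun.bilinear_simps scaleC_blinfun.rep_eq diff_eq_eq add.commute)
  then have "M (op_exp (\<omega> *\<^sub>R A) (G \<omega>)) = (M o\<^sub>L ?D) (y 0)" by simp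
  then have "M (op_exp (\<omega> *\<^sub>R A) (G \<omega>)) = y 0"
    unfolding M_def op_inverse(1)[OF inv] by simp
  then show ?thesis using yt[OF t] by simp
qed

lemma bvp_solution_exists:
  fixes A :: "'a::complex_banach \<Rightarrow>\<^sub>L 'a"
  assumes "\<omega> > 0" and inv: "op_invertible (c *\<^sub>C id_blinfun - op_exp (\<omega> *\<^sub>R A))"
    and f: "continuous_on {0..\<omega>} f"
  shows "\<exists>y. bvp_solution A \<omega> c f y"
proof -
  let ?D = "c *\<^sub>C id_blinfun - op_exp (\<omega> *\<^sub>R A)"
  define G where "G = (\<lambda>t. integral {0..t} (\<lambda>s. op_exp ((- s) *\<^sub>R A) (f s)))"
  \<comment> \<open>The initial value forced by the boundary condition.\<close>
  define x where "x = op_inverse ?D (op_exp (\<omega> *\<^sub>R A) (G \<omega>))"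
  define y where "y = (\<lambda>t. op_exp (t *\<^sub>R A) (x + G t))"
  have deriv: "(y has_vector_derivative A (y t) + f t) (at t within {0..\<omega>})" if "t \<in> {0..\<omega>}" for t
    unfolding y_def G_def by (rule op_exp_convolution_has_vector_derivative[OF f that])
  have "?D x = (?D o\<^sub>L op_inverse ?D) (op_exp (\<omega> *\<^sub>R A) (G \<omega>))" by (simp add: x_def)
  then have "?D x = op_exp (\<omega> *\<^sub>R A) (G \<omega>)"
    unfolding op_inverse(2)[OF inv] by simp
  then have "y \<omega> = c *\<^sub>C y 0"
    by (simp add: y_def G_def blinfun.bilinear_simps scaleC_blinfun.rep_eq algebra_simps)
  \<comment> \<open>Restricting supplies the dummy values demanded by \<open>bvp_solution\<close>
    and leaves derivatives within the interval unchanged.\<close>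
  moreover have deriv': "(restrict y {0..\<omega>} has_vector_derivative A (y t) + f t) (at t within {0..\<omega>})"
    if "t \<in> {0..\<omega>}" for t
    by (rule has_vector_derivative_transform[OF that _ deriv[OF that]]) simp
  moreover have "continuous_on {0..\<omega>} (restrict y {0..\<omega>})"
    by (rule continuous_on_vector_derivative[OF deriv'])
  ultimately have "bvp_solution A \<omega> c f (restrict y {0..\<omega>})"
    using \<open>\<omega> > 0\<close> by (simp add: bvp_solution_def)
  then show ?thesis by blast
qed

text \<open>On each side of s = t the kernel is a fixed operator composed with e^(-sA), so the two
  partial integrals are such operators applied to G(t) and to G(\<omega>) - G(t).\<close>

lemma bvp_kernel_has_integral:
  fixes A :: "'a::complex_banach \<Rightarrow>\<^sub>L 'a"
  assumes "A \<in> clinear_ops" and inv: "op_invertible (c *\<^sub>C id_blinfun - op_exp (\<omega> *\<^sub>R A))"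
    and f: "continuous_on {0..\<omega>} f" and t: "t \<in> {0..\<omega>}"
  defines "M \<equiv> op_inverse (c *\<^sub>C id_blinfun - op_exp (\<omega> *\<^sub>R A))"
  defines "G \<equiv> \<lambda>t. integral {0..t} (\<lambda>s. op_exp ((- s) *\<^sub>R A) (f s))"
  shows "((\<lambda>s. bvp_kernel A \<omega> c t s (f s)) has_integral
    op_exp (t *\<^sub>R A) (M (op_exp (\<omega> *\<^sub>R A) (G \<omega>)) + G t)) {0..\<omega>}"
proof -
  let ?D = "c *\<^sub>C id_blinfun - op_exp (\<omega> *\<^sub>R A)"
  let ?E = "\<lambda>t. op_exp (t *\<^sub>R A)"
  have E: "?E s \<in> clinear_ops" for s
    by (intro clinear_ops_op_exp clinear_ops_scaleR assms)
  have EE: "?E s o\<^sub>L ?E r = ?E r o\<^sub>L ?E s" for s r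
    by (metis op_exp_add_scaleR add.commute)
  have ME: "M o\<^sub>L ?E s = ?E s o\<^sub>L M" for s
    unfolding M_def by (rule op_inverse_commute[OF inv]) (simp add: blinfun_compose_simps E EE)
  have MD: "M o\<^sub>L ?D = id_blinfun"
    unfolding M_def by (rule op_inverse(1)[OF inv])
  have int: "(\<lambda>s. ?E (- s) (f s)) integrable_on {0..\<omega>}"
    by (intro integrable_continuous_real continuous_on_op_exp_neg_apply f)
  have i1: "((\<lambda>s. ?E (- s) (f s)) has_integral G t) {0..t}"
    unfolding G_def by (intro integrable_integral integrable_subinterval_real[OF int]) (use t in auto)
  have i2: "((\<lambda>s. ?E (- s) (f s)) has_integral (G \<omega> - G t)) {t..\<omega>}"
  proof -
    have "(\<lambda>s. ?E (- s) (f s)) integrable_on {t..\<omega>}"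
      by (rule integrable_subinterval_real[OF int]) (use t in auto)
    moreover have "G t + integral {t..\<omega>} (\<lambda>s. ?E (- s) (f s)) = G \<omega>"
      unfolding G_def by (rule Henstock_Kurzweil_Integration.integral_combine) (use t int in auto)
    ultimately show ?thesis by (metis add_diff_cancel_left' integrable_integral)
  qed
  have k1: "bvp_kernel A \<omega> c t s (f s) = (c *\<^sub>C (?E t o\<^sub>L M)) (?E (- s) (f s))"
    if "s \<in> {0..t}" for s
  proof -
    have "c *\<^sub>C ?E (t - s) o\<^sub>L M = (c *\<^sub>C (?E t o\<^sub>L M)) o\<^sub>L ?E (- s)"
      using op_exp_add_scaleR[of t "- s" A]
      by (simp add: scaleC_blinfun_compose_left blinfun_compose_assoc ME del: scaleR_minus_left)
    then show ?thesis using that by (simp add: bvp_kernel_def M_def flip: blinfun_apply_blinfun_compose)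
  qed
  \<comment> \<open>At s = t the kernel takes its first branch; this single point does not affect
    the integral.\<close>
  have k2: "bvp_kernel A \<omega> c t s (f s) = (?E t o\<^sub>L M o\<^sub>L ?E \<omega>) (?E (- s) (f s))"
    if "s \<in> {t..\<omega>} - {t}" for s
  proof -
    have "?E (\<omega> + t - s) = ?E t o\<^sub>L (?E \<omega> o\<^sub>L ?E (- s))"
      using op_exp_add_scaleR[of t "\<omega> - s" A] op_exp_add_scaleR[of \<omega> "- s" A]
      by (simp add: algebra_simps)
    then have "?E (\<omega> + t - s) o\<^sub>L M = (?E t o\<^sub>L M o\<^sub>L ?E \<omega>) o\<^sub>L ?E (- s)"
      by (metis blinfun_compose_assoc ME)
    then show ?thesis using that by (simp add: bvp_kernel_def M_def flip: blinfun_apply_blinfun_compose)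
  qed
  have "((\<lambda>s. bvp_kernel A \<omega> c t s (f s)) has_integral
      (c *\<^sub>C (?E t o\<^sub>L M)) (G t) + (?E t o\<^sub>L M o\<^sub>L ?E \<omega>) (G \<omega> - G t)) {0..\<omega>}"
  proof (rule has_integral_combine)
    show "((\<lambda>s. bvp_kernel A \<omega> c t s (f s)) has_integral (c *\<^sub>C (?E t o\<^sub>L M)) (G t)) {0..t}"
      by (rule has_integral_eq[OF k1[symmetric] has_integral_blinfun[OF i1]])
    show "((\<lambda>s. bvp_kernel A \<omega> c t s (f s)) has_integral (?E t o\<^sub>L M o\<^sub>L ?E \<omega>) (G \<omega> - G t)) {t..\<omega>}"
      by (rule has_integral_spike_finite[where S = "{t}", OF _ k2 has_integral_blinfun[OF i2]]) simp
  qed (use t in auto)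
  \<comment> \<open>The identity M (c - e^(\<omega>A)) = 1 merges the two contributions of G(t) into
    e^(tA) G(t).\<close>
  moreover have "(c *\<^sub>C (?E t o\<^sub>L M)) (G t) + (?E t o\<^sub>L M o\<^sub>L ?E \<omega>) (G \<omega> - G t) =
      ?E t (M (?E \<omega> (G \<omega>)) + G t)"
  proof -
    have M: "M \<in> clinear_ops"
      unfolding M_def using inv op_inverse_eqI unfolding op_invertible_def by blast
    have "G t = (M o\<^sub>L ?D) (G t)" unfolding MD by simp
    also have "\<dots> = c *\<^sub>C M (G t) - M (?E \<omega> (G t))"
      using M by (simp add: blinfun.bilinear_simps scaleC_blinfun.rep_eq clinear_ops_def)
    finally have "?E t (G t) = ?E t (c *\<^sub>C M (G t) - M (?E \<omega> (G t)))"
      by (rule arg_cong)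
    also have "\<dots> = c *\<^sub>C ?E t (M (G t)) - ?E t (M (?E \<omega> (G t)))"
      using E[of t] by (simp add: blinfun.bilinear_simps clinear_ops_def)
    finally show ?thesis
      by (simp add: blinfun.bilinear_simps scaleC_blinfun.rep_eq)
  qed
  ultimately show ?thesis by simp
qed

text \<open>Invertibility is asserted as well because it gives meaning to the definite description
  \<open>op_inverse\<close> in the kernel; \<open>has_integral\<close> includes existence of the
  integral.\<close>

theorem lemma2p3:
  fixes A :: "'a::complex_banach \<Rightarrow>\<^sub>L 'a"
    and \<omega> :: real and c :: complex and f :: "real \<Rightarrow> 'a"
  assumes "A \<in> clinear_ops"
    and "\<omega> > 0"
    and "c \<noteq> 0"
    and "\<And>\<mu>. \<mu> \<in> op_spectrum A \<Longrightarrow> c \<noteq> exp (complex_of_real \<omega> * \<mu>)"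
    and "continuous_on UNIV f"
    and "\<And>t. f (t + \<omega>) = c *\<^sub>C f t"
  shows "op_invertible (c *\<^sub>C id_blinfun - op_exp (\<omega> *\<^sub>R A)) \<and>
    (\<exists>!y. bvp_solution A \<omega> c f y) \<and>
    (\<forall>y. bvp_solution A \<omega> c f y \<longrightarrow>
       (\<forall>t\<in>{0..\<omega>}. ((\<lambda>s. blinfun_apply (bvp_kernel A \<omega> c t s) (f s)) has_integral y t) {0..\<omega>}))"
proof (intro conjI)
  have \<omega>: "\<omega> *\<^sub>R A = complex_of_real \<omega> *\<^sub>C A" by (simp add: scaleC_of_real)
  show inv: "op_invertible (c *\<^sub>C id_blinfun - op_exp (\<omega> *\<^sub>R A))"
  proof (rule op_invertible_minus_op_exp)
    fix \<mu> assume "\<mu> \<in> op_spectrum (\<omega> *\<^sub>R A)"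
    then have "\<mu> / complex_of_real \<omega> \<in> op_spectrum A"
      unfolding \<omega> using assms(1,2) by (intro op_spectrum_scaleC) auto
    from assms(4)[OF this] show "c \<noteq> exp \<mu>" using assms(2) by simp
  qed (use assms(1,3) in \<open>simp_all add: clinear_ops_scaleR\<close>)
  have f: "continuous_on {0..\<omega>} f" using assms(5) continuous_on_subset by blast
  note formula = bvp_solution_formula[OF assms(2) inv]
  \<comment> \<open>The right-hand side of the solution formula is free of the solution, so any two
    agree on [0,\<omega>]; extensionality settles the other arguments.\<close>
  have "y = z" if "bvp_solution A \<omega> c f y" "bvp_solution A \<omega> c f z" for y z
    by (rule extensionalityI[of _ "{0..\<omega>}"])
      (use that formula[OF that(1)] formula[OF that(2)] in \<open>simp_all add: bvp_solution_def\<close>)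
  then show "\<exists>!y. bvp_solution A \<omega> c f y"
    using bvp_solution_exists[OF assms(2) inv f] by blast
  have "((\<lambda>s. blinfun_apply (bvp_kernel A \<omega> c t s) (f s)) has_integral y t) {0..\<omega>}"
    if "bvp_solution A \<omega> c f y" "t \<in> {0..\<omega>}" for y t
    unfolding formula[OF that] by (rule bvp_kernel_has_integral[OF assms(1) inv f that(2)])
  then show "\<forall>y. bvp_solution A \<omega> c f y \<longrightarrow>
      (\<forall>t\<in>{0..\<omega>}. ((\<lambda>s. blinfun_apply (bvp_kernel A \<omega> c t s) (f s)) has_integral y t) {0..\<omega>})"
    by blast
qed

end
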